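(* For every positive integer $n$: every caterpillar $T$ on $n$ vertices satisfies $h(T)\ge n/6$, and every haircomb $T$ on $n$ vertices satisfies $h(T)\ge \sqrt{n}/2$.
   Context: For a graph $G$ and $S\subseteq V(G)$, the distance multiset $D(S)$ is the multiset of shortest-path distances in $G$ between all unordered pairs of distinct vertices of $S$. Two vertex sets $S_1,S_2$ are homometric if $D(S_1)=D(S_2)$. $h(G)$ is the largest integer $h$ such that $G$ contains two disjoint homometric sets $S_1,S_2$ with $|S_1|=|S_2|=h$. A caterpillar is a tree that is the union of a path (the spine) and leaves adjacent to vertices of the spine. A haircomb is a tree that is the union of a path $P$ (the spine) and a collection of pairwise vertex-disjoint paths (the legs), each leg having exactly one vertex in common with $P$, this vertex being an endpoint of the leg.
   Formalization: The formal theorem assumes n ≥ 2 instead of every positive integer n: for n = 1 the single vertex is both a caterpillar and a haircomb with h = 0, which is less than 1/6 and 1/2, so the claim fails there. *)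

theory Defs
  imports
    Complex_Main
    "HOL-Library.Multiset"
    "Graph_Theory.Graph_Theory"
begin

text \<open>
  Finite simple graphs are the symmetric loop-free digraphs of \<^locale>\<open>pair_graph\<close>: an
  undirected edge is a pair of opposite arcs.  The library predicates \<^const>\<open>forest\<close> and
  \<^const>\<open>tree\<close> are of no use here, since in a symmetric digraph every edge already gives
  a directed cycle of length two; undirected cycles need at least three vertices.
\<close>

definition is_tree :: "'a pair_pre_digraph \<Rightarrow> bool" where
  "is_tree T \<longleftrightarrow> pair_graph T \<and> connected (with_proj T) \<and>
     \<not> (\<exists>p. length p \<ge> 3 \<and> vpath p (with_proj T) \<and> (last p, hd p) \<in> parcs T)"

definition gdist :: "'a pair_pre_digraph \<Rightarrow> 'a \<Rightarrow> 'a \<Rightarrow> ereal" where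
  "gdist G u v = wf_digraph.\<mu> (with_proj G) (\<lambda>_. 1) u v"

text \<open>
  The distance of an unordered pair, given as a two-element set; in a graph it does not
  depend on the order in which the two vertices are taken.
\<close>

definition pair_dist :: "'a pair_pre_digraph \<Rightarrow> 'a set \<Rightarrow> ereal" where
  "pair_dist G e = (THE d. \<exists>u v. u \<noteq> v \<and> e = {u, v} \<and> d = gdist G u v)"

lemma gdist_le:
  assumes "pair_graph G"
  shows "gdist G u v \<le> gdist G v u"
proof -
  interpret pair_graph G by fact
  show ?thesis
    unfolding gdist_def \<mu>_def
  proof (rule INF_greatest)
    fix p assume "p \<in> {p. awalk v p u}"
    then have aw: "awalk u (rev_path p) v"
      by (simp only: awalk_rev_path mem_Collect_eq)
    have "length (rev_path p) = length p"
      by (induction p) simp_all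
    moreover have "awalk_cost (\<lambda>_. 1) q = real (length q)" for q
      by (induction q) simp_all
    ultimately have eq: "awalk_cost (\<lambda>_. 1) (rev_path p) = awalk_cost (\<lambda>_. 1) p"
      by simp
    have "(INF p\<in>{p. awalk u p v}. ereal (awalk_cost (\<lambda>_. 1) p))
            \<le> ereal (awalk_cost (\<lambda>_. 1) (rev_path p))"
      using aw by (intro INF_lower) (simp only: mem_Collect_eq)
    then show "(INF p\<in>{p. awalk u p v}. ereal (awalk_cost (\<lambda>_. 1) p))
            \<le> ereal (awalk_cost (\<lambda>_. 1) p)"
      by (simp only: eq)
  qed
qed

lemma pair_dist_eq:
  assumes "pair_graph G" "u \<noteq> v"
  shows "pair_dist G {u, v} = gdist G u v"
proof -
  have "gdist G v u = gdist G u v"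
    using gdist_le[OF assms(1)] by (simp add: antisym)
  then show ?thesis
    unfolding pair_dist_def using assms(2) by (auto simp: doubleton_eq_iff intro!: the_equality)
qed

definition dist_mset :: "'a pair_pre_digraph \<Rightarrow> 'a set \<Rightarrow> ereal multiset" where
  "dist_mset G S = image_mset (pair_dist G) (mset_set {e. e \<subseteq> S \<and> card e = 2})"

definition homometric :: "'a pair_pre_digraph \<Rightarrow> 'a set \<Rightarrow> 'a set \<Rightarrow> bool" where
  "homometric G S\<^sub>1 S\<^sub>2 \<longleftrightarrow> dist_mset G S\<^sub>1 = dist_mset G S\<^sub>2"

definition hom_number :: "'a pair_pre_digraph \<Rightarrow> nat" where
  "hom_number G = Max {h. \<exists>S\<^sub>1 S\<^sub>2. S\<^sub>1 \<subseteq> pverts G \<and> S\<^sub>2 \<subseteq> pverts G \<and> S\<^sub>1 \<inter> S\<^sub>2 = {} \<and>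
     card S\<^sub>1 = h \<and> card S\<^sub>2 = h \<and> homometric G S\<^sub>1 S\<^sub>2}"

definition is_leaf :: "'a pair_pre_digraph \<Rightarrow> 'a \<Rightarrow> bool" where
  "is_leaf G v \<longleftrightarrow> v \<in> pverts G \<and> out_degree (with_proj G) v = 1"

text \<open>
  The arcs of a caterpillar need no separate description: by acyclicity the only edges
  besides those of the spine are the ones joining the leaves to it.
\<close>

definition caterpillar :: "'a pair_pre_digraph \<Rightarrow> bool" where
  "caterpillar T \<longleftrightarrow> is_tree T \<and>
     (\<exists>p L. vpath p (with_proj T) \<and>
            (\<forall>v\<in>L. is_leaf T v \<and> (\<exists>u\<in>set p. (u, v) \<in> parcs T)) \<and>
            pverts T = set p \<union> L)"

definition path_arcs :: "'a list \<Rightarrow> 'a rel" where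
  "path_arcs p = (set (vwalk_arcs p))\<^sup>s"

text \<open>
  A path is a list of vertices, so a leg may be listed starting from its vertex on the spine.
\<close>

definition haircomb :: "'a pair_pre_digraph \<Rightarrow> bool" where
  "haircomb T \<longleftrightarrow> is_tree T \<and>
     (\<exists>p L. vpath p (with_proj T) \<and>
            (\<forall>l\<in>L. vpath l (with_proj T) \<and> set l \<inter> set p = {hd l}) \<and>
            (\<forall>l\<in>L. \<forall>m\<in>L. l \<noteq> m \<longrightarrow> set l \<inter> set m = {}) \<and>
            pverts T = set p \<union> (\<Union>l\<in>L. set l) \<and>
            parcs T = path_arcs p \<union> (\<Union>l\<in>L. path_arcs l))"

text \<open>
  With a single vertex the only admissible sets are empty, so the positive lower bounds
  \<open>n / 6\<close> and \<open>sqrt n / 2\<close> on \<open>hom_number\<close> can only hold for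
  \<open>n \<ge> 2\<close>: the one-vertex graph is both a caterpillar and a haircomb.
\<close>

lemma hom_number_one_vertex:
  assumes "card (pverts G) = 1"
  shows "hom_number G = 0"
proof -
  let ?H = "{h. \<exists>S\<^sub>1 S\<^sub>2. S\<^sub>1 \<subseteq> pverts G \<and> S\<^sub>2 \<subseteq> pverts G \<and> S\<^sub>1 \<inter> S\<^sub>2 = {} \<and>
     card S\<^sub>1 = h \<and> card S\<^sub>2 = h \<and> homometric G S\<^sub>1 S\<^sub>2}"
  obtain x where x: "pverts G = {x}"
    using assms by (rule card_1_singletonE)
  have "h = 0" if "h \<in> ?H" for h
  proof -
    from that obtain S\<^sub>1 S\<^sub>2 where S: "S\<^sub>1 \<subseteq> {x}" "S\<^sub>2 \<subseteq> {x}" "S\<^sub>1 \<inter> S\<^sub>2 = {}" "card S\<^sub>1 = h" "card S\<^sub>2 = h"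
      unfolding x by blast
    then have "S\<^sub>1 = {} \<or> S\<^sub>2 = {}"
      by blast
    with S show ?thesis
      by (metis card.empty)
  qed
  moreover have "0 \<in> ?H"
    unfolding homometric_def mem_Collect_eq by (intro exI[of _ "{}"]) simp
  ultimately have "?H = {0}"
    by (intro equalityI subsetI insertI1) (simp_all only: singleton_iff)
  then show ?thesis
    unfolding hom_number_def by simp
qed

lemma one_vertex_caterpillar_haircomb:
  "caterpillar \<lparr>pverts = {x}, parcs = {}\<rparr>" "haircomb \<lparr>pverts = {x}, parcs = {}\<rparr>"
proof -
  let ?T = "\<lparr>pverts = {x}, parcs = {}\<rparr>"
  have "pair_graph ?T"
    by unfold_locales (auto simp: symmetric_def sym_def)
  moreover have "connected (with_proj ?T)"
    by (auto simp: connected_def mk_symmetric_def strongly_connected_def reachable_def)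
  ultimately have tree: "is_tree ?T"
    by (simp add: is_tree_def)
  have path: "vpath [x] (with_proj ?T)"
    by (auto simp: vpath_def vwalk_def)
  have "pverts ?T = set [x] \<union> {}"
    by simp
  with tree path show "caterpillar ?T"
    unfolding caterpillar_def by blast
  have "parcs ?T = path_arcs [x] \<union> (\<Union>l\<in>{}. path_arcs l)"
    by (simp add: path_arcs_def symcl_def)
  moreover have "pverts ?T = set [x] \<union> (\<Union>l\<in>{}. set l)"
    by simp
  ultimately show "haircomb ?T"
    unfolding haircomb_def using tree path by blast
qed

end

theory Submission
  imports Defs
begin

text \<open>
  In a tree the distance of two vertices is the length of the only path between them, so the two
  halves of any path are homometric, and exchanging pendant vertices attached to the same vertex
  preserves distances.

  Caterpillars: take a dominating path of maximal length \<open>k\<close>.  No pendant vertex is attached to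
  either of its ends, so splitting the pendant vertices at each inner vertex into two halves gives
  homometric sets of size at least \<open>(n - k - (k - 2)) / 2\<close>, while the halves of the path have size
  at least \<open>(k - 1) / 2\<close>; the larger of the two is at least \<open>n / 6\<close>.

  Haircombs: if every path has at most \<open>2 h + 1\<close> vertices, then so do the spine and each leg
  continued along the spine in either direction, which leaves room for at most \<open>4 h\<^sup>2\<close> vertices.
\<close>

section \<open>Path lists, halving a finite set, and the counting bound for combs\<close>

text \<open>Trading \<open>vwalk_arcs\<close> for \<open>successively\<close> makes concatenating,
  cutting and reversing paths a matter of simplification.\<close>

lemma vpath_iff:
  "vpath p (with_proj G) \<longleftrightarrow>
     p \<noteq> [] \<and> set p \<subseteq> pverts G \<and> distinct p \<and> successively (\<lambda>u v. (u, v) \<in> parcs G) p"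
proof -
  have "set (vwalk_arcs p) \<subseteq> parcs G \<longleftrightarrow> successively (\<lambda>u v. (u, v) \<in> parcs G) p"
    by (induction p rule: vwalk_arcs.induct) auto
  then show ?thesis
    by (auto simp: vpath_def vwalk_def)
qed

text \<open>The complement of a subset of size \<open>card N div 2\<close> is at least as large, so
  it has room for a disjoint copy. The copy is given as an image so that \<open>f\<close> can serve
  as an exchange map.\<close>

lemma ex_half_bij:
  assumes "finite N"
  shows "\<exists>A f. A \<subseteq> N \<and> f ` A \<subseteq> N \<and> A \<inter> f ` A = {} \<and> inj_on f A \<and> card A = card N div 2"
proof -
  obtain A where A: "A \<subseteq> N" "card A = card N div 2"
    using obtain_subset_with_card_n[of "card N div 2" N] by auto
  have "card N div 2 \<le> card (N - A)"
    using A assms by (simp add: card_Diff_subset finite_subset)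
  then obtain B where B: "B \<subseteq> N - A" "card B = card N div 2"
    using obtain_subset_with_card_n by metis
  have "finite A" "finite B"
    using A B assms by (auto intro: finite_subset)
  then obtain f where "bij_betw f A B"
    using A B finite_same_card_bij by metis
  with A B show ?thesis
    by (intro exI[of _ A] exI[of _ f]) (auto simp: bij_betw_def)
qed

text \<open>The number \<open>b i\<close> of vertices in the comb tooth at position \<open>i\<close> counts the spine vertex.\<close>

lemma comb_count:
  fixes b :: "nat \<Rightarrow> nat"
  assumes "k \<le> 2 * h + 1" "h \<ge> 1"
    and left: "\<And>i. i < k \<Longrightarrow> b i + i \<le> 2 * h + 1"
    and right: "\<And>i. i < k \<Longrightarrow> b i + (k - 1 - i) \<le> 2 * h + 1"
  shows "(\<Sum>i<k. b i) \<le> 4 * h\<^sup>2"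
proof -
  have hh: "h \<le> h * h"
    by (rule le_square)
  consider "k = 0" | "k = 1" | "2 \<le> k" "k \<le> 2 * h" | "k = 2 * h + 1"
    using assms(1) by linarith
  then show ?thesis
  proof cases
    case 2
    then have "(\<Sum>i<k. b i) \<le> 2 * h + 1"
      using left[of 0] by simp
    also have "\<dots> \<le> 4 * (h * h)"
      using hh assms(2) by linarith
    finally show ?thesis
      by (simp add: power2_eq_square)
  next
    case 3
    \<comment> \<open>As \<open>k\<close> is at least 2, every position has spine on some side:
      position 0 loses a vertex by \<open>right\<close>, all others by \<open>left\<close>.\<close>
    have "(\<Sum>i<k. b i) \<le> (\<Sum>i<k. 2 * h)"
    proof (rule sum_mono)
      fix i assume "i \<in> {..<k}"
      with left[of i] right[of i] 3 show "b i \<le> 2 * h"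
        by (cases "i = 0") auto
    qed
    also have "\<dots> \<le> (2 * h) * (2 * h)"
      using 3 by simp
    finally show ?thesis
      by (simp add: power2_eq_square)
  next
    case 4
    \<comment> \<open>The uniform bound \<open>2 * h\<close> would give
      \<open>(2 * h + 1) * (2 * h)\<close>, which is too much. On a spine this long, however, the
      two end teeth have at most one vertex each.\<close>
    have "(\<Sum>i<k. b i) = b 0 + (\<Sum>i\<in>{1..<2 * h}. b i) + b (2 * h)"
    proof -
      have "{..<k} = insert 0 (insert (2 * h) {1..<2 * h})"
        using 4 assms(2) by auto
      then show ?thesis
        using assms(2) by simp
    qed
    moreover have "b 0 \<le> 1" "b (2 * h) \<le> 1"
      using left[of "2 * h"] right[of 0] 4 by auto
    moreover have "(\<Sum>i\<in>{1..<2 * h}. b i) \<le> (\<Sum>i\<in>{1..<2 * h}. 2 * h)"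
    proof (rule sum_mono)
      fix i assume "i \<in> {1..<2 * h}"
      with left[of i] 4 show "b i \<le> 2 * h"
        by auto
    qed
    ultimately have "(\<Sum>i<k. b i) \<le> 2 + (2 * h - 1) * (2 * h)"
      by simp
    also have "\<dots> \<le> 4 * h\<^sup>2"
    proof -
      have "(2 * h - 1) * (2 * h) + 2 * h = 4 * h\<^sup>2"
        using assms(2) by (cases h) (simp_all add: power2_eq_square algebra_simps)
      with assms(2) show ?thesis
        by linarith
    qed
    finally show ?thesis .
  qed simp
qed

section \<open>Walks, paths and homometric sets in a graph\<close>

context pair_graph
begin

lemma parcs_commute: "(u, v) \<in> parcs G \<longleftrightarrow> (v, u) \<in> parcs G"
  using pair_sym_arcs by (auto simp: symmetric_def sym_def)

lemma vpath_rev: "vpath (rev p) (with_proj G) \<longleftrightarrow> vpath p (with_proj G)"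
  by (simp add: vpath_iff parcs_commute)

lemma vpath_length_le: "vpath p (with_proj G) \<Longrightarrow> length p \<le> card (pverts G)"
  by (metis vpath_iff distinct_card card_mono pair_finite_verts)

text \<open>Shortcutting: if the start already lies on the path obtained from the rest of the walk,
  the part before it is dropped; otherwise it is prepended.\<close>

lemma awalk_imp_short_vpath:
  assumes "awalk u q v"
  shows "\<exists>p. vpath p (with_proj G) \<and> hd p = u \<and> last p = v \<and> length p \<le> Suc (length q)"
  using assms
proof (induction q arbitrary: u)
  case Nil
  then show ?case
    by (intro exI[of _ "[u]"]) (auto simp: awalk_Nil_iff vpath_iff)
next
  case (Cons e q)
  then have e: "(u, snd e) \<in> parcs G" and q: "awalk (snd e) q v"
    by (auto simp: awalk_Cons_iff)
  from Cons.IH[OF q] obtain p where p: "vpath p (with_proj G)" "hd p = snd e" "last p = v"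
      "length p \<le> Suc (length q)"
    by blast
  show ?case
  proof (cases "u \<in> set p")
    case True
    then obtain a b where ab: "p = a @ u # b"
      by (auto simp: in_set_conv_decomp)
    with p show ?thesis
      by (intro exI[of _ "u # b"]) (auto simp: vpath_iff successively_append_iff)
  next
    case False
    with p e show ?thesis
      by (intro exI[of _ "u # p"])
        (auto simp: vpath_iff successively_Cons intro: in_arcsD1)
  qed
qed

lemma vpath_imp_awalk:
  assumes "vpath p (with_proj G)"
  shows "\<exists>q. awalk (hd p) q (last p) \<and> length q = length p - 1"
  using assms
proof (induction p rule: induct_list012)
  case (2 x)
  then show ?case
    by (intro exI[of _ "[]"]) (auto simp: awalk_Nil_iff vpath_iff)
next
  case (3 x y zs)
  then have "vpath (y # zs) (with_proj G)" and xy: "(x, y) \<in> parcs G"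
    by (auto simp: vpath_iff)
  with 3 obtain q where "awalk y q (last (y # zs))" "length q = length zs"
    by auto
  with xy show ?case
    by (intro exI[of _ "(x, y) # q"]) (auto simp: awalk_Cons_iff intro: in_arcsD1)
qed (simp add: vpath_iff)

lemma gdist_commute: "gdist G u v = gdist G v u"
  using gdist_le[OF pair_graph] by (simp add: antisym)

text \<open>An injective map preserving distances on \<open>S\<close> induces a bijection of
  two-element subsets that preserves \<open>pair_dist\<close>.\<close>

lemma homometricI:
  assumes "finite S" "inj_on f S"
    and dist: "\<And>u v. u \<in> S \<Longrightarrow> v \<in> S \<Longrightarrow> u \<noteq> v \<Longrightarrow> gdist G (f u) (f v) = gdist G u v"
  shows "homometric G S (f ` S)"
proof -
  let ?E = "\<lambda>S. {e. e \<subseteq> S \<and> card e = 2}"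
  have "?E (f ` S) = (`) f ` ?E S"
  proof (intro equalityI subsetI)
    fix e assume "e \<in> ?E (f ` S)"
    then obtain d where d: "d \<subseteq> S" "e = f ` d" and "card e = 2"
      by (auto simp: subset_image_iff)
    with assms(2) have "card d = 2"
      by (metis card_image inj_on_subset)
    with d show "e \<in> (`) f ` ?E S"
      by auto
  next
    fix e assume "e \<in> (`) f ` ?E S"
    then obtain d where "d \<subseteq> S" "e = f ` d" "card d = 2"
      by auto
    with assms(2) show "e \<in> ?E (f ` S)"
      by (auto simp: card_image inj_on_subset)
  qed
  moreover have "inj_on ((`) f) (?E S)"
    using assms(2) by (intro inj_onI) (auto simp: inj_on_image_eq_iff)
  ultimately have "mset_set (?E (f ` S)) = image_mset ((`) f) (mset_set (?E S))"
    by (simp add: image_mset_mset_set)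
  moreover have "pair_dist G (f ` e) = pair_dist G e" if "e \<in> ?E S" for e
  proof -
    from that obtain u v where "e = {u, v}" "u \<noteq> v" "u \<in> S" "v \<in> S"
      by (auto simp: card_2_iff)
    with assms show ?thesis
      by (simp add: pair_dist_eq[OF pair_graph] inj_on_eq_iff)
  qed
  ultimately show ?thesis
    using assms(1)
    by (auto simp: homometric_def dist_mset_def multiset.map_comp intro!: image_mset_cong)
qed

lemma hom_number_ge:
  assumes "S \<subseteq> pverts G" "S' \<subseteq> pverts G" "S \<inter> S' = {}" "card S' = card S" "homometric G S S'"
  shows "card S \<le> hom_number G"
  unfolding hom_number_def
proof (rule Max_ge)
  \<comment> \<open>\<open>Max\<close> bounds its members only on a finite set; here all sizes are
    at most the number of vertices.\<close>
  show "finite {h. \<exists>S\<^sub>1 S\<^sub>2. S\<^sub>1 \<subseteq> pverts G \<and> S\<^sub>2 \<subseteq> pverts G \<and> S\<^sub>1 \<inter> S\<^sub>2 = {} \<and>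
      card S\<^sub>1 = h \<and> card S\<^sub>2 = h \<and> homometric G S\<^sub>1 S\<^sub>2}"
    by (rule finite_subset[of _ "{..card (pverts G)}"])
      (auto intro: card_mono pair_finite_verts)
qed (use assms in auto)

lemma hom_number_ge_isometry:
  assumes "S \<subseteq> pverts G" "f ` S \<subseteq> pverts G" "S \<inter> f ` S = {}" "inj_on f S"
    and "\<And>u v. u \<in> S \<Longrightarrow> v \<in> S \<Longrightarrow> u \<noteq> v \<Longrightarrow> gdist G (f u) (f v) = gdist G u v"
  shows "card S \<le> hom_number G"
  using assms by (intro hom_number_ge[of S "f ` S"] homometricI)
    (auto simp: card_image intro: finite_subset pair_finite_verts)

end

section \<open>Unique paths and distances in acyclic graphs\<close>

locale acyclic_graph = pair_graph +
  assumes no_cycle: "vpath p (with_proj G) \<Longrightarrow> length p \<ge> 3 \<Longrightarrow> (last p, hd p) \<notin> parcs G"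

lemma is_tree_imp_acyclic_graph: "is_tree T \<Longrightarrow> acyclic_graph T"
  unfolding is_tree_def acyclic_graph_def acyclic_graph_axioms_def by blast

context acyclic_graph
begin

text \<open>Two paths that leave their common start by different arcs but meet again would enclose a
  cycle; so the second vertices agree and induction applies to the tails.\<close>

lemma vpath_unique:
  assumes "vpath p (with_proj G)" "vpath q (with_proj G)" "hd p = hd q" "last p = last q"
  shows "p = q"
  using assms
proof (induction p arbitrary: q)
  case Nil
  then show ?case
    by (simp add: vpath_iff)
next
  case (Cons u p)
  then obtain q' where q: "q = u # q'"
    by (cases q) (auto simp: vpath_iff)
  have ends: "last (u # p) = last (u # q')"
    using Cons.prems q by simp
  have u: "u \<notin> set p" "u \<notin> set q'"
    using Cons.prems q by (auto simp: vpath_iff)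
  show ?case
  proof (cases "p = [] \<or> q' = []")
    \<comment> \<open>The common last vertex is then \<open>u\<close>, which does not recur, so both
      tails are empty.\<close>
    case True
    with ends u q show ?thesis
      by (metis last_ConsL last_ConsR last_in_set)
  next
    case False
    then have sub: "vpath p (with_proj G)" "vpath q' (with_proj G)" "last p = last q'"
      and arcs: "(u, hd p) \<in> parcs G" "(u, hd q') \<in> parcs G"
      using Cons.prems q by (auto simp: vpath_iff successively_Cons)
    have "hd p = hd q'"
    proof (rule ccontr)
      assume ne: "hd p \<noteq> hd q'"
      have "\<exists>x\<in>set p. x \<in> set q'"
        using sub(3) False by (metis last_in_set)
      then obtain a x b where p: "p = a @ x # b" and x: "x \<in> set q'" and a: "\<forall>y\<in>set a. y \<notin> set q'"
        by (rule split_list_first_propE)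
      from x obtain c d where q': "q' = c @ x # d"
        by (auto simp: in_set_conv_decomp)
      have "a \<noteq> [] \<or> c \<noteq> []"
        using ne p q' by auto
      \<comment> \<open>Out along \<open>p\<close> up to \<open>x\<close> and back along
        \<open>q'\<close> to its head, which is adjacent to \<open>u\<close>. Since the heads
        differ, \<open>a\<close> and \<open>c\<close> are not both empty, so at least three vertices
        occur.\<close>
      let ?r = "u # a @ [x] @ rev c"
      have "vpath ?r (with_proj G)"
        using Cons.prems(1) sub arcs u a unfolding vpath_iff p q'
        by (auto simp: successively_append_iff successively_Cons hd_append last_rev hd_rev
            parcs_commute split: if_splits)
      moreover have "length ?r \<ge> 3"
        using \<open>a \<noteq> [] \<or> c \<noteq> []\<close> by (cases a; cases c) auto
      moreover have "(last ?r, hd ?r) \<in> parcs G"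
        using arcs(2) q' by (cases c) (auto simp: parcs_commute)
      ultimately show False
        using no_cycle by blast
    qed
    with Cons.IH[OF sub(1,2)] sub(3) q show ?thesis
      by simp
  qed
qed

text \<open>The path itself is a walk of this cost. Conversely, any walk between its ends shortens
  to a path, which by uniqueness is \<open>p\<close>, so no walk is cheaper.\<close>

lemma gdist_vpath:
  assumes "vpath p (with_proj G)"
  shows "gdist G (hd p) (last p) = ereal (real (length p - 1))"
proof -
  have cost: "awalk_cost (\<lambda>_. 1) q = real (length q)" for q
    by (induction q) simp_all
  show ?thesis
    unfolding gdist_def \<mu>_def
  proof (rule antisym)
    show "(INF q\<in>{q. awalk (hd p) q (last p)}. ereal (awalk_cost (\<lambda>_. 1) q))
        \<le> ereal (real (length p - 1))"
      using vpath_imp_awalk[OF assms] by (auto simp: cost intro: INF_lower2)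
  next
    have "length p - 1 \<le> length q" if "awalk (hd p) q (last p)" for q
      using awalk_imp_short_vpath[OF that] vpath_unique[OF assms] by fastforce
    then show "ereal (real (length p - 1))
        \<le> (INF q\<in>{q. awalk (hd p) q (last p)}. ereal (awalk_cost (\<lambda>_. 1) q))"
      by (auto simp: cost intro!: INF_greatest)
  qed
qed

lemma vpath_segment:
  assumes "vpath p (with_proj G)" "i \<le> j" "j < length p"
  defines "q \<equiv> take (Suc (j - i)) (drop i p)"
  shows "vpath q (with_proj G)" "hd q = p ! i" "last q = p ! j" "length q = Suc (j - i)"
    "set q \<subseteq> set p"
proof -
  show len: "length q = Suc (j - i)"
    using assms by (simp add: q_def)
  have p: "p = take i p @ q @ drop (Suc (j - i)) (drop i p)"
    by (simp only: q_def append_take_drop_id)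
  with assms(1) len show "vpath q (with_proj G)"
    unfolding vpath_iff by (metis Un_subset_iff distinct_append length_0_conv nat.distinct(1)
        set_append successively_append_iff)
  show "hd q = p ! i" "set q \<subseteq> set p"
    using assms(2,3) by (auto simp: q_def hd_drop_conv_nth dest: in_set_takeD in_set_dropD)
  show "last q = p ! j"
    using assms(2,3) len by (subst last_conv_nth) (auto simp: q_def)
qed

lemma gdist_nth:
  assumes "vpath p (with_proj G)" "i < length p" "j < length p"
  shows "gdist G (p ! i) (p ! j) = ereal \<bar>real i - real j\<bar>"
proof -
  have *: "gdist G (p ! i) (p ! j) = ereal \<bar>real i - real j\<bar>" if "i \<le> j" "j < length p" for i j
    using gdist_vpath[OF vpath_segment(1)[OF assms(1) that]] vpath_segment(2-4)[OF assms(1) that] that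
    by (simp add: of_nat_diff)
  show ?thesis
    using *[of i j] *[of j i] assms by (cases "i \<le> j") (auto simp: gdist_commute abs_minus_commute)
qed

text \<open>The path from \<open>u\<close> to \<open>v\<close> is a segment of \<open>p\<close> with
  one extra edge at each end. The value depends only on the attachment positions, which is what
  allows pendant vertices to be exchanged; \<open>i = j\<close> gives distance 2.\<close>

lemma gdist_pendant:
  assumes p: "vpath p (with_proj G)" and "i < length p" "j < length p"
    and "u \<notin> set p" "v \<notin> set p" "u \<noteq> v" "(p ! i, u) \<in> parcs G" "(p ! j, v) \<in> parcs G"
  shows "gdist G u v = ereal (\<bar>real i - real j\<bar> + 2)"
proof -
  have *: "gdist G u v = ereal (\<bar>real i - real j\<bar> + 2)"
    if ij: "i \<le> j" "j < length p" and uv: "u \<notin> set p" "v \<notin> set p" "u \<noteq> v"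
      "(p ! i, u) \<in> parcs G" "(p ! j, v) \<in> parcs G" for i j u v
  proof -
    obtain q where q: "vpath q (with_proj G)" "hd q = p ! i" "last q = p ! j" "length q = Suc (j - i)"
        "set q \<subseteq> set p"
      using vpath_segment[OF p ij] by blast
    have "vpath (u # q @ [v]) (with_proj G)"
      using q uv unfolding vpath_iff
      by (auto simp: successively_append_iff successively_Cons parcs_commute intro: in_arcsD2)
    from gdist_vpath[OF this] q(4) ij show ?thesis
      by (simp add: of_nat_diff)
  qed
  show ?thesis
    using *[of i j u v] *[of j i v u] assms
    by (cases "i \<le> j") (auto simp: gdist_commute abs_minus_commute)
qed

section \<open>Homometric sets from paths and from pendant vertices\<close>

text \<open>Translation by \<open>h\<close> positions maps the first \<open>h\<close> vertices to
  the next \<open>h\<close> and preserves differences of positions, hence distances. For odd length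
  the last vertex stays out.\<close>

lemma hom_number_ge_half_path:
  assumes p: "vpath p (with_proj G)"
  shows "length p div 2 \<le> hom_number G"
proof -
  define h where "h = length p div 2"
  then have h: "h + h \<le> length p"
    by simp
  have inj: "inj_on ((!) p) {..<length p}"
    using p by (auto simp: inj_on_def vpath_iff nth_eq_iff_index_eq)
  define S where "S = (!) p ` {..<h}"
  define f where "f x = p ! (the_inv_into {..<length p} ((!) p) x + h)" for x
  have f: "f (p ! i) = p ! (i + h)" if "i < h" for i
    using that h by (simp add: f_def the_inv_into_f_f[OF inj])
  have fS: "f ` S = (\<lambda>i. p ! (i + h)) ` {..<h}"
    unfolding S_def image_image using f by (intro image_cong) auto
  have d: "p ! i = p ! j \<longleftrightarrow> i = j" if "i < length p" "j < length p" for i j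
    using p that by (simp add: vpath_iff nth_eq_iff_index_eq)
  have "card S \<le> hom_number G"
  proof (rule hom_number_ge_isometry[of S f])
    show "S \<subseteq> pverts G"
      using p h unfolding S_def by (auto simp: vpath_iff)
    show "f ` S \<subseteq> pverts G"
      using p h unfolding fS by (auto simp: vpath_iff)
    show "S \<inter> f ` S = {}"
      using h unfolding fS unfolding S_def by (auto simp: d)
    show "inj_on f S"
      using h unfolding S_def by (auto simp: inj_on_def f d)
    show "gdist G (f u) (f v) = gdist G u v" if "u \<in> S" "v \<in> S" for u v
      using that h unfolding S_def by (auto simp: f gdist_nth[OF p])
  qed
  moreover have "card S = h"
    unfolding S_def using h inj by (simp add: card_image inj_on_subset)
  ultimately show ?thesis
    by (simp add: h_def)
qed

text \<open>At each path vertex the attached vertices are paired off, with at most one left over,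
  and partners are exchanged. Attachments do not change, so neither do distances.\<close>

lemma hom_number_ge_pendant:
  assumes p: "vpath p (with_proj G)" and X: "X \<subseteq> pverts G - set p"
    and nb: "\<And>v. v \<in> X \<Longrightarrow> nb v \<in> set p \<and> (nb v, v) \<in> parcs G"
  shows "(\<Sum>x\<in>set p. card {v \<in> X. nb v = x} div 2) \<le> hom_number G"
proof -
  let ?N = "\<lambda>x. {v \<in> X. nb v = x}"
  have fin: "finite (?N x)" for x
    using X pair_finite_verts by (auto intro: finite_subset)
  then have "\<forall>x. \<exists>A f. A \<subseteq> ?N x \<and> f ` A \<subseteq> ?N x \<and> A \<inter> f ` A = {} \<and> inj_on f A \<and>
      card A = card (?N x) div 2"
    by (intro allI ex_half_bij)
  then obtain A f where "\<forall>x. A x \<subseteq> ?N x \<and> f x ` A x \<subseteq> ?N x \<and> A x \<inter> f x ` A x = {} \<and>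
      inj_on (f x) (A x) \<and> card (A x) = card (?N x) div 2"
    unfolding choice_iff by blast
  then have A: "A x \<subseteq> ?N x" "f x ` A x \<subseteq> ?N x" "A x \<inter> f x ` A x = {}"
      "inj_on (f x) (A x)" "card (A x) = card (?N x) div 2" for x
    by blast+
  define S where "S = (\<Union>x\<in>set p. A x)"
  \<comment> \<open>Glues the local exchanges: \<open>v\<close> in \<open>A x\<close> has
    \<open>nb v = x\<close>, so the attachment vertex selects the right one.\<close>
  define g where "g v = f (nb v) v" for v
  have S: "v \<in> A (nb v)" if "v \<in> S" for v
    using that A(1) by (auto simp: S_def)
  have g: "g v \<in> X" "nb (g v) = nb v" if "v \<in> S" for v
    using S[OF that] A(2)[of "nb v"] by (auto simp: g_def)
  have SX: "S \<subseteq> X"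
    using A(1) by (auto simp: S_def)
  have inj: "inj_on g S"
  proof (rule inj_onI)
    fix u v assume uv: "u \<in> S" "v \<in> S" "g u = g v"
    then have "nb u = nb v"
      using g(2) by metis
    with uv S[of u] S[of v] A(4)[of "nb v"] show "u = v"
      by (auto simp: g_def inj_on_def)
  qed
  have dist: "gdist G (g u) (g v) = gdist G u v" if uv: "u \<in> S" "v \<in> S" "u \<noteq> v" for u v
  proof -
    have "g u \<noteq> g v"
      using inj uv by (simp add: inj_on_eq_iff)
    have mem: "u \<in> X" "v \<in> X" "g u \<in> X" "g v \<in> X"
      using uv SX g by auto
    with nb obtain i j where ij: "i < length p" "p ! i = nb u" "j < length p" "p ! j = nb v"
      by (metis in_set_conv_nth)
    have pend: "w \<notin> set p" "(nb w, w) \<in> parcs G" if "w \<in> X" for w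
      using that X nb by auto
    have "gdist G u v = ereal (\<bar>real i - real j\<bar> + 2)"
      by (rule gdist_pendant[OF p ij(1,3)]) (use pend mem ij uv in auto)
    moreover have "gdist G (g u) (g v) = ereal (\<bar>real i - real j\<bar> + 2)"
      by (rule gdist_pendant[OF p ij(1,3)])
        (use pend(1) pend(2)[OF mem(3)] pend(2)[OF mem(4)] mem ij uv g(2) \<open>g u \<noteq> g v\<close> in auto)
    ultimately show ?thesis
      by simp
  qed
  have "card S \<le> hom_number G"
  proof (rule hom_number_ge_isometry[of S g])
    show "S \<subseteq> pverts G" "g ` S \<subseteq> pverts G"
      using SX X g by auto
    \<comment> \<open>Since \<open>g\<close> keeps attachments, an overlap would occur at a single
      path vertex, where the two halves are disjoint.\<close>
    show "S \<inter> g ` S = {}"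
    proof (rule ccontr)
      assume "S \<inter> g ` S \<noteq> {}"
      then obtain v where v: "v \<in> S" "g v \<in> S"
        by auto
      then have "g v \<in> A (nb v)"
        using S[of "g v"] g(2) by metis
      then show False
        using S[OF v(1)] A(3)[of "nb v"] by (auto simp: g_def)
    qed
  qed (use inj dist in auto)
  moreover have "card S = (\<Sum>x\<in>set p. card (A x))"
    unfolding S_def
  proof (rule card_UN_disjoint)
    show "\<forall>x\<in>set p. finite (A x)"
      using finite_subset[OF A(1) fin] by blast
    show "\<forall>x\<in>set p. \<forall>y\<in>set p. x \<noteq> y \<longrightarrow> A x \<inter> A y = {}"
      using A(1) by blast
  qed simp
  ultimately show ?thesis
    by (simp add: A(5))
qed

section \<open>The bound for caterpillars\<close>

text \<open>Domination is the form of the caterpillar property that survives prolonging the path by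
  a pendant vertex, so a longest dominating path can be used.\<close>

lemma dominating_vpath_imp_hom_number_ge:
  assumes "vpath p (with_proj G)" "\<forall>v\<in>pverts G - set p. \<exists>u\<in>set p. (u, v) \<in> parcs G"
    and n: "card (pverts G) \<ge> 2"
  shows "card (pverts G) \<le> 6 * hom_number G"
proof -
  define D where "D p \<longleftrightarrow> vpath p (with_proj G) \<and>
    (\<forall>v\<in>pverts G - set p. \<exists>u\<in>set p. (u, v) \<in> parcs G)" for p
  have "\<exists>p. D p \<and> (\<forall>q. D q \<longrightarrow> length q \<le> length p)"
    using assms vpath_length_le
    by (intro ex_has_greatest_nat[of D p length "Suc (card (pverts G))"])
      (auto simp: D_def less_Suc_eq_le)
  then obtain p where "D p" and longest: "\<And>q. D q \<Longrightarrow> length q \<le> length p"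
    by blast
  then have p: "vpath p (with_proj G)"
    and dom: "\<And>v. v \<in> pverts G - set p \<Longrightarrow> \<exists>u\<in>set p. (u, v) \<in> parcs G"
    by (auto simp: D_def)
  define X where "X = pverts G - set p"
  obtain nb where nb: "\<And>v. v \<in> X \<Longrightarrow> nb v \<in> set p \<and> (nb v, v) \<in> parcs G"
    using dom unfolding X_def by metis
  let ?N = "\<lambda>x. {v \<in> X. nb v = x}"
  \<comment> \<open>A vertex attached to an end could be added there, giving a longer dominating
    path.\<close>
  have "nb v \<noteq> hd p" if "v \<in> X" for v
  proof
    assume "nb v = hd p"
    with that p nb[OF that] have "vpath (v # p) (with_proj G)"
      by (auto simp: X_def vpath_iff successively_Cons parcs_commute)
    moreover have "\<exists>u\<in>set (v # p). (u, w) \<in> parcs G" if "w \<in> pverts G - set (v # p)" for w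
      using dom[of w] that by auto
    ultimately have "D (v # p)"
      unfolding D_def by blast
    then show False
      using longest by fastforce
  qed
  moreover have "nb v \<noteq> last p" if "v \<in> X" for v
  proof
    assume "nb v = last p"
    with that p nb[OF that] have "vpath (p @ [v]) (with_proj G)"
      by (auto simp: X_def vpath_iff successively_append_iff)
    moreover have "\<exists>u\<in>set (p @ [v]). (u, w) \<in> parcs G" if "w \<in> pverts G - set (p @ [v])" for w
      using dom[of w] that by auto
    ultimately have "D (p @ [v])"
      unfolding D_def by blast
    then show False
      using longest by fastforce
  qed
  ultimately have inner: "nb v \<in> set p - {hd p, last p}" if "v \<in> X" for v
    using that nb by blast
  have pne: "p \<noteq> []" and dist: "distinct p" and sub: "set p \<subseteq> pverts G"
    using p by (auto simp: vpath_iff)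
  have fX: "finite X"
    using pair_finite_verts by (simp add: X_def)
  have cardX: "card X + length p = card (pverts G)"
    using card_mono[OF pair_finite_verts sub] sub distinct_card[OF dist]
    by (simp add: X_def card_Diff_subset)
  \<comment> \<open>Makes the two ends distinct, so that exactly \<open>length p - 2\<close> inner
    vertices remain. On a single vertex nothing could be attached, leaving one vertex in
    all.\<close>
  have "length p \<noteq> 1"
  proof
    assume "length p = 1"
    then obtain x where "p = [x]"
      by (auto simp: length_Suc_conv)
    with inner have "X = {}"
      by auto
    with cardX \<open>length p = 1\<close> n show False
      by simp
  qed
  with pne have len: "length p \<ge> 2"
    by (cases p) (auto simp: Suc_le_eq)
  have "hd p \<noteq> last p"
    using len dist by (cases p) auto
  then have card_inner: "card (set p - {hd p, last p}) + 2 = length p"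
    using pne dist len by (simp add: card_Diff_subset distinct_card)
  have "card X = (\<Sum>x\<in>set p - {hd p, last p}. card (?N x))"
  proof -
    have "X = (\<Union>x\<in>set p - {hd p, last p}. ?N x)"
      using inner by auto
    also have "card \<dots> = (\<Sum>x\<in>set p - {hd p, last p}. card (?N x))"
      using fX by (intro card_UN_disjoint) auto
    finally show ?thesis .
  qed
  \<comment> \<open>Halving wastes at most one vertex per inner vertex of the path.\<close>
  also have "\<dots> \<le> (\<Sum>x\<in>set p - {hd p, last p}. 2 * (card (?N x) div 2) + 1)"
    by (intro sum_mono) linarith
  also have "\<dots> = 2 * (\<Sum>x\<in>set p - {hd p, last p}. card (?N x) div 2)
      + card (set p - {hd p, last p})"
    by (simp only: sum.distrib sum_distrib_left card_eq_sum)
  also have "(\<Sum>x\<in>set p - {hd p, last p}. card (?N x) div 2) \<le> (\<Sum>x\<in>set p. card (?N x) div 2)"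
    by (intro sum_mono2) auto
  also have "\<dots> \<le> hom_number G"
    using p nb by (intro hom_number_ge_pendant) (auto simp: X_def)
  finally have "card X + 2 \<le> 2 * hom_number G + length p"
    using card_inner by simp
  \<comment> \<open>With \<open>H\<close> the homometric number and \<open>k = length p\<close>, the
    order is at most \<open>2 H + 2 k - 2\<close>, and \<open>k \<le> 2 H + 1\<close> turns this
    into \<open>6 H\<close>.\<close>
  with hom_number_ge_half_path[OF p] cardX show ?thesis
    by linarith
qed

section \<open>The bound for haircombs\<close>

text \<open>Halving a path bounds its length by \<open>2 h + 1\<close>. Applied to each tooth
  continued along the spine to the left and to the right, this yields the hypotheses of
  \<open>comb_count\<close>.\<close>

lemma comb_imp_hom_number_ge:
  assumes p: "vpath p (with_proj G)"
    and leg: "\<And>l. l \<in> L \<Longrightarrow> vpath l (with_proj G) \<and> set l \<inter> set p = {hd l}"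
    and disj: "\<And>l m. l \<in> L \<Longrightarrow> m \<in> L \<Longrightarrow> l \<noteq> m \<Longrightarrow> set l \<inter> set m = {}"
    and verts: "pverts G = set p \<union> (\<Union>l\<in>L. set l)"
    and h1: "hom_number G \<ge> 1"
  shows "card (pverts G) \<le> 4 * (hom_number G)\<^sup>2"
proof -
  define h where "h = hom_number G"
  have short: "length q \<le> 2 * h + 1" if "vpath q (with_proj G)" for q
    using hom_number_ge_half_path[OF that] by (simp add: h_def)
  \<comment> \<open>The tooth at position \<open>i\<close>; \<open>insert\<close> covers spine
    vertices without a leg. Two legs starting at the same spine vertex would intersect, so each
    tooth is a single path.\<close>
  define B where "B i = insert (p ! i) (\<Union>l\<in>{l \<in> L. hd l = p ! i}. set l)" for i
  have B: "\<exists>q. vpath q (with_proj G) \<and> set q \<inter> set p = {hd q} \<and> hd q = p ! i \<and> B i = set q"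
    if i: "i < length p" for i
  proof (cases "\<exists>l\<in>L. hd l = p ! i")
    case True
    then obtain l where l: "l \<in> L" "hd l = p ! i"
      by blast
    have "m = l" if "m \<in> L" "hd m = p ! i" for m
    proof (rule ccontr)
      assume "m \<noteq> l"
      moreover have "p ! i \<in> set l" "p ! i \<in> set m"
        using leg[OF l(1)] leg[OF that(1)] l(2) that(2) by auto
      ultimately show False
        using disj[of m l] that(1) l(1) by blast
    qed
    with l have "{l \<in> L. hd l = p ! i} = {l}"
      by blast
    then have "B i = insert (p ! i) (set l)"
      by (simp add: B_def)
    moreover have "p ! i \<in> set l"
      using leg[OF l(1)] l(2) by auto
    ultimately show ?thesis
      using leg[OF l(1)] l(2) by (intro exI[of _ l]) auto
  next
    case False
    then have "B i = {p ! i}"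
      by (auto simp: B_def)
    with i p show ?thesis
      by (intro exI[of _ "[p ! i]"]) (auto simp: vpath_iff)
  qed
  have bound: "card (B i) + i \<le> 2 * h + 1 \<and> card (B i) + (length p - 1 - i) \<le> 2 * h + 1"
    if i: "i < length p" for i
  proof -
    obtain q where q: "vpath q (with_proj G)" "set q \<inter> set p = {hd q}" "hd q = p ! i" "B i = set q"
      using B[OF i] by blast
    then have card: "card (B i) = length q"
      by (simp add: vpath_iff distinct_card)
    have split: "p = take i p @ p ! i # drop (Suc i) p"
      using i by (rule id_take_nth_drop)
    have ni: "p ! i \<notin> set (take i p)" "p ! i \<notin> set (drop (Suc i) p)"
      using p split unfolding vpath_iff by (metis distinct_append disjoint_iff list.set_intros(1),
          metis distinct_append distinct.simps(2))
    have sub: "set (take i p) \<subseteq> set p" "set (drop (Suc i) p) \<subseteq> set p"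
      by (auto dest: in_set_takeD in_set_dropD)
    have meet: "x = p ! i" if "x \<in> set q" "x \<in> set p" for x
      using q(2,3) that by auto
    have disj': "set (take i p) \<inter> set q = {}" "set q \<inter> set (drop (Suc i) p) = {}"
      using meet sub ni by blast+
    have succ: "successively (\<lambda>u v. (u, v) \<in> parcs G) (take i p @ p ! i # drop (Suc i) p)"
      using p split by (metis vpath_iff)
    \<comment> \<open>\<open>q\<close> starts at the spine vertex, so it can follow the left part of
      the spine as it is, but must be reversed to lead into the right part.\<close>
    have "vpath (take i p @ q) (with_proj G)"
      using p q succ disj' sub unfolding vpath_iff
      by (auto simp: successively_append_iff)
    moreover have "vpath (rev q @ drop (Suc i) p) (with_proj G)"
      using p q succ disj' sub unfolding vpath_iff
      by (auto simp: successively_append_iff successively_Cons last_rev parcs_commute)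
    ultimately have "length (take i p @ q) \<le> 2 * h + 1"
      "length (rev q @ drop (Suc i) p) \<le> 2 * h + 1"
      by (blast intro: short)+
    with card i show ?thesis
      by simp
  qed
  have "pverts G \<subseteq> (\<Union>i\<in>{..<length p}. B i)"
  proof
    fix v assume "v \<in> pverts G"
    then consider "v \<in> set p" | l where "l \<in> L" "v \<in> set l"
      using verts by auto
    then show "v \<in> (\<Union>i\<in>{..<length p}. B i)"
    proof cases
      case 1
      then show ?thesis
        by (auto simp: in_set_conv_nth B_def)
    next
      case 2
      then have "hd l \<in> set p"
        using leg by blast
      then obtain i where "i < length p" "p ! i = hd l"
        by (auto simp: in_set_conv_nth)
      with 2 show ?thesis
        by (auto simp: B_def intro!: bexI[of _ i])
    qed
  qed
  moreover have fin: "finite (B i)" if "i < length p" for i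
    using B[OF that] by auto
  ultimately have "card (pverts G) \<le> card (\<Union>i\<in>{..<length p}. B i)"
    by (intro card_mono) auto
  also have "\<dots> \<le> (\<Sum>i<length p. card (B i))"
    by (intro card_UN_le) simp
  also have "\<dots> \<le> 4 * h\<^sup>2"
    using bound short[OF p] h1 by (intro comb_count) (auto simp: h_def)
  finally show ?thesis
    by (simp add: h_def)
qed

end

section \<open>Positivity and the two bounds\<close>

text \<open>Two distinct singletons are homometric, both having an empty distance multiset. This
  supplies \<open>h \<ge> 1\<close> for the comb count.\<close>

lemma tree_hom_number_pos:
  assumes "is_tree T" "card (pverts T) \<ge> 2"
  shows "hom_number T \<ge> 1"
proof -
  interpret acyclic_graph T
    using assms(1) by (rule is_tree_imp_acyclic_graph)
  obtain u v where uv: "u \<in> pverts T" "v \<in> pverts T" "u \<noteq> v"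
    using assms(2) by (metis card_le_Suc0_iff_eq pair_finite_verts not_less_eq_eq numeral_2_eq_2)
  have "card {u} \<le> hom_number T"
    using uv by (intro hom_number_ge_isometry[of "{u}" "\<lambda>_. v"]) auto
  then show ?thesis
    by simp
qed

theorem theorem5:
  fixes n :: nat
  assumes "n \<ge> 2"
  shows "(\<forall>T :: 'a pair_pre_digraph. caterpillar T \<and> card (pverts T) = n \<longrightarrow>
            real (hom_number T) \<ge> real n / 6) \<and>
         (\<forall>T :: 'a pair_pre_digraph. haircomb T \<and> card (pverts T) = n \<longrightarrow>
            real (hom_number T) \<ge> sqrt (real n) / 2)"
proof (intro conjI allI impI; elim conjE)
  fix T :: "'a pair_pre_digraph"
  assume T: "caterpillar T" "card (pverts T) = n"
  then interpret acyclic_graph T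
    by (auto simp: caterpillar_def is_tree_imp_acyclic_graph)
  from T(1) obtain p L where "vpath p (with_proj T)"
      "\<forall>v\<in>L. is_leaf T v \<and> (\<exists>u\<in>set p. (u, v) \<in> parcs T)" "pverts T = set p \<union> L"
    unfolding caterpillar_def by blast
  \<comment> \<open>Vertices off the spine lie in \<open>L\<close>, so the spine dominates.\<close>
  then have "n \<le> 6 * hom_number T"
    using dominating_vpath_imp_hom_number_ge[of p] T(2) assms by auto
  then show "real (hom_number T) \<ge> real n / 6"
    by linarith
next
  fix T :: "'a pair_pre_digraph"
  assume T: "haircomb T" "card (pverts T) = n"
  then interpret acyclic_graph T
    by (auto simp: haircomb_def is_tree_imp_acyclic_graph)
  have "hom_number T \<ge> 1"
    using T assms by (intro tree_hom_number_pos) (simp_all add: haircomb_def)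
  moreover from T(1) obtain p L where "vpath p (with_proj T)"
      "\<forall>l\<in>L. vpath l (with_proj T) \<and> set l \<inter> set p = {hd l}"
      "\<forall>l\<in>L. \<forall>m\<in>L. l \<noteq> m \<longrightarrow> set l \<inter> set m = {}" "pverts T = set p \<union> (\<Union>l\<in>L. set l)"
    unfolding haircomb_def by (elim conjE exE) (rule that)
  ultimately have "n \<le> 4 * (hom_number T)\<^sup>2"
    unfolding T(2)[symmetric] by (intro comb_imp_hom_number_ge[of p L]) auto
  then have "real n \<le> real (4 * (hom_number T)\<^sup>2)"
    by (simp only: of_nat_le_iff)
  then have "sqrt (real n) \<le> 2 * real (hom_number T)"
    by (intro real_le_lsqrt) (simp_all add: power_mult_distrib)
  then show "real (hom_number T) \<ge> sqrt (real n) / 2"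
    by simp
qed

end
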